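(* Fix positive integers $d$ and $|T|$, and allow the number of voters and the set of candidates to vary. Every profile with horizon $|T|$ and at most $d$ first choices per round admits a sequence satisfying all-rank-JR if and only if $|T|\left(1-\frac1d\right)^{|T|}<1$. The same characterization holds for all-rank-wJR. A single polynomial-time online rule, which is given neither $d$ nor $|T|$, achieves all positive cases (i.e., whenever $|T|(1-1/d)^{|T|}<1$, its output satisfies all-rank-JR on every profile with horizon $|T|$ and at most $d$ first choices per round).
   Context: Model. Voters $V=[n]$, a set $C$ of $m$ candidates, rounds $T=\{1,\dots,|T|\}$ with $n,m,|T|\ge1$; $|T|$ is the horizon. In each round $j$ each voter $i$ has a strict complete ranking of $C$; her most-preferred candidate is her first choice in round $j$. "At most $d$ first choices per round" means that in every round at most $d$ distinct candidates are the first choice of some voter. For $r\in[m]$, $A_i^j(r)$ is the set of voter $i$'s $r$ most-preferred candidates in round $j$. A sequence is $W=(w^1,\dots,w^{|T|})\in C^{|T|}$. A group is a nonempty $S\subseteq V$. A rule is online if each $w^j$ depends only on the rankings in rounds $1,\dots,j$ and not on $|T|$. All-rank axioms. A rank matrix is $R=(r_i^j)\in[m]^{|T|\times n}$. Under $R$, a group $S$ agrees in round $j$ if $\bigcap_{i\in S}A_i^j(r_i^j)\ne\varnothing$, and is represented in round $j$ if $w^j\in\bigcup_{i\in S}A_i^j(r_i^j)$. $W$ satisfies all-rank-JR if, for every rank matrix $R$, every group $S$ that agrees in $k>0$ rounds under $R$ and satisfies $|S|\ge n/k$ is represented in at least one round. All-rank-wJR is this requirement restricted to groups agreeing in every round ($k=|T|$).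 *)

theory Defs
  imports Complex_Main "HOL-Computational_Algebra.Polynomial"
begin

section \<open>Profiles\<close>

text \<open>
  Candidates are named by natural numbers; since only finite candidate sets occur, this loses no
  generality. Rounds and voters are numbered from 0, so \<open>P ! j ! i\<close> is the ranking (best
  candidate first) of voter \<open>i\<close> in round \<open>j\<close>, and the horizon is \<open>length P\<close>.
\<close>

type_synonym cand = nat
type_synonym profile = "cand list list list"

definition is_profile :: "nat \<Rightarrow> cand set \<Rightarrow> nat \<Rightarrow> profile \<Rightarrow> bool" where
  "is_profile n C T P \<longleftrightarrow>
     n \<ge> 1 \<and> finite C \<and> C \<noteq> {} \<and> T \<ge> 1 \<and> length P = T \<and>
     (\<forall>j<T. length (P ! j) = n \<and> (\<forall>i<n. distinct (P ! j ! i) \<and> set (P ! j ! i) = C))"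

definition first_choices :: "nat \<Rightarrow> profile \<Rightarrow> nat \<Rightarrow> cand set" where
  "first_choices n P j = {hd (P ! j ! i) | i. i < n}"

definition at_most_first_choices :: "nat \<Rightarrow> nat \<Rightarrow> profile \<Rightarrow> bool" where
  "at_most_first_choices d n P \<longleftrightarrow> (\<forall>j<length P. card (first_choices n P j) \<le> d)"

definition is_outcome :: "cand set \<Rightarrow> nat \<Rightarrow> cand list \<Rightarrow> bool" where
  "is_outcome C T W \<longleftrightarrow> length W = T \<and> set W \<subseteq> C"


section \<open>All-rank axioms\<close>

text \<open>\<open>top_set P j i r\<close> is the set of the \<open>r\<close> candidates that voter \<open>i\<close> likes best in round \<open>j\<close>.\<close>

definition top_set :: "profile \<Rightarrow> nat \<Rightarrow> nat \<Rightarrow> nat \<Rightarrow> cand set" where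
  "top_set P j i r = set (take r (P ! j ! i))"

definition rank_matrix :: "nat \<Rightarrow> nat \<Rightarrow> nat \<Rightarrow> (nat \<Rightarrow> nat \<Rightarrow> nat) \<Rightarrow> bool" where
  "rank_matrix m T n R \<longleftrightarrow> (\<forall>j<T. \<forall>i<n. 1 \<le> R j i \<and> R j i \<le> m)"

definition group :: "nat \<Rightarrow> nat set \<Rightarrow> bool" where
  "group n S \<longleftrightarrow> S \<noteq> {} \<and> S \<subseteq> {..<n}"

definition agrees :: "profile \<Rightarrow> (nat \<Rightarrow> nat \<Rightarrow> nat) \<Rightarrow> nat set \<Rightarrow> nat \<Rightarrow> bool" where
  "agrees P R S j \<longleftrightarrow> (\<Inter>i\<in>S. top_set P j i (R j i)) \<noteq> {}"

definition represented ::
    "profile \<Rightarrow> (nat \<Rightarrow> nat \<Rightarrow> nat) \<Rightarrow> cand list \<Rightarrow> nat set \<Rightarrow> nat \<Rightarrow> bool" where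
  "represented P R W S j \<longleftrightarrow> W ! j \<in> (\<Union>i\<in>S. top_set P j i (R j i))"

definition all_rank_JR :: "nat \<Rightarrow> cand set \<Rightarrow> nat \<Rightarrow> profile \<Rightarrow> cand list \<Rightarrow> bool" where
  "all_rank_JR n C T P W \<longleftrightarrow>
     (\<forall>R S k. rank_matrix (card C) T n R \<and> group n S \<and>
        k = card {j. j < T \<and> agrees P R S j} \<and> k > 0 \<and> real (card S) \<ge> real n / real k
        \<longrightarrow> (\<exists>j<T. represented P R W S j))"

definition all_rank_wJR :: "nat \<Rightarrow> cand set \<Rightarrow> nat \<Rightarrow> profile \<Rightarrow> cand list \<Rightarrow> bool" where
  "all_rank_wJR n C T P W \<longleftrightarrow>
     (\<forall>R S. rank_matrix (card C) T n R \<and> group n S \<and>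
        (\<forall>j<T. agrees P R S j) \<and> real (card S) \<ge> real n / real T
        \<longrightarrow> (\<exists>j<T. represented P R W S j))"


section \<open>Online rules\<close>

text \<open>
  An online rule is a function \<open>f\<close> of the history: the winner of a round is \<open>f\<close> applied to the
  rankings of the rounds up to and including this one. The number of voters and the candidate set
  can be read off the history; the horizon cannot.
\<close>

definition online_outcome :: "(profile \<Rightarrow> cand) \<Rightarrow> profile \<Rightarrow> cand list" where
  "online_outcome f P = map (\<lambda>j. f (take (Suc j) P)) [0..<length P]"

definition online_rule :: "(profile \<Rightarrow> cand) \<Rightarrow> bool" where
  "online_rule f \<longleftrightarrow>
     (\<forall>n C T P. is_profile n C T P \<longrightarrow> is_outcome C T (online_outcome f P))"


section \<open>Polynomial time\<close>

text \<open>
  The machine model is a random access machine with structured control flow: finitely many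
  registers (per program), a memory of natural numbers addressed indirectly through registers,
  and unit cost per instruction and per test. The only arithmetic is addition and truncated
  subtraction, so in \<open>t\<close> steps the bit length of the numbers grows by at most \<open>t\<close> (beyond the
  constants in the program); hence polynomial time on this machine is the same as polynomial
  time on Turing machines.
\<close>

type_synonym reg = nat
type_synonym state = "(reg \<Rightarrow> nat) \<times> (nat \<Rightarrow> nat)"

datatype com =
    Const reg nat
  | Add reg reg reg
  | Sub reg reg reg
  | Load reg reg
  | Store reg reg
  | Seq com com
  | If reg com com
  | While reg com

text \<open>\<open>exec c s t s'\<close>: started in state \<open>s\<close>, program \<open>c\<close> halts after \<open>t\<close> steps in state \<open>s'\<close>.
  A register holding 0 counts as false.\<close>

inductive exec :: "com \<Rightarrow> state \<Rightarrow> nat \<Rightarrow> state \<Rightarrow> bool" where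
  Const: "exec (Const a v) (r, m) 1 (r(a := v), m)"
| Add: "exec (Add a b c) (r, m) 1 (r(a := r b + r c), m)"
| Sub: "exec (Sub a b c) (r, m) 1 (r(a := r b - r c), m)"
| Load: "exec (Load a b) (r, m) 1 (r(a := m (r b)), m)"
| Store: "exec (Store a b) (r, m) 1 (r, m(r a := r b))"
| Seq: "exec c1 s t1 s' \<Longrightarrow> exec c2 s' t2 s'' \<Longrightarrow> exec (Seq c1 c2) s (t1 + t2) s''"
| IfTrue: "r a \<noteq> 0 \<Longrightarrow> exec c1 (r, m) t s' \<Longrightarrow> exec (If a c1 c2) (r, m) (t + 1) s'"
| IfFalse: "r a = 0 \<Longrightarrow> exec c2 (r, m) t s' \<Longrightarrow> exec (If a c1 c2) (r, m) (t + 1) s'"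
| WhileFalse: "r a = 0 \<Longrightarrow> exec (While a c) (r, m) 1 (r, m)"
| WhileTrue: "r a \<noteq> 0 \<Longrightarrow> exec c (r, m) t1 s' \<Longrightarrow> exec (While a c) s' t2 s'' \<Longrightarrow>
    exec (While a c) (r, m) (t1 + t2 + 1) s''"

definition initial_state :: "nat list \<Rightarrow> state" where
  "initial_state xs = (\<lambda>_. 0, \<lambda>a. if a < length xs then xs ! a else 0)"

text \<open>
  The input for a history consists of the numbers of rounds (so far), voters and candidates,
  followed by all rankings, round by round and voter by voter.
\<close>

definition encode :: "profile \<Rightarrow> nat list" where
  "encode P = [length P, length (P ! 0), length (P ! 0 ! 0)] @ concat (map concat P)"

text \<open>
  The output is left in register 0. The running time is measured against the number of words of
  the input, which is at most its bit length.
\<close>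

definition poly_time :: "(profile \<Rightarrow> cand) \<Rightarrow> bool" where
  "poly_time f \<longleftrightarrow>
     (\<exists>(c :: com) (p :: nat poly). \<forall>n C T P. is_profile n C T P \<longrightarrow>
        (\<exists>t r m. exec c (initial_state (encode P)) t (r, m) \<and>
           t \<le> poly p (length (encode P)) \<and> r 0 = f P))"

end

theory Submission
  imports Defs "HOL-Library.FuncSet"
begin

text \<open>
  A group that is never represented consists of voters none of whom ever gets her first choice,
  because ranks are at least 1. In each round let the candidate win who is the first choice of most
  voters that have not received a first choice yet; with at most \<open>d\<close> first choices per round
  this serves at least a \<open>1/d\<close> fraction of them, so at most \<open>n (1 - 1/d)\<^sup>T\<close> voters are never
  served. If this is less than \<open>n/T\<close>, then no group of never served voters is large enough to
  violate all-rank-JR.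

  Conversely, let the voters be all functions from rounds to \<open>{0, \<dots>, d - 1}\<close>, and in each round let
  a voter of type \<open>a\<close> rank the candidates cyclically as \<open>a, a + 1, \<dots>\<close> modulo \<open>d\<close>. Whatever wins,
  all voters without their first choice prefer its cyclic predecessor, so the
  \<open>(d - 1)\<^sup>T = n (1 - 1/d)\<^sup>T\<close> voters who never get their first choice agree in every round when their
  ranks stop just above the winner.
\<close>

section \<open>The greedy rule\<close>

text \<open>Candidates are addressed through the voters who rank them first, so the search for a
  plurality winner runs over the voters \<open>0, ..., n - 1\<close>. Voter \<open>i\<close> may lie
  outside \<open>U\<close>.\<close>

definition support :: "(nat \<Rightarrow> cand) \<Rightarrow> nat set \<Rightarrow> nat \<Rightarrow> nat" where
  "support h U i = card {i' \<in> U. h i' = h i}"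

text \<open>Ties go to the larger index, matching the comparison made in \<open>pick_loop\<close>;
  the value at 0 is a default for the empty range.\<close>

fun last_argmax :: "(nat \<Rightarrow> nat) \<Rightarrow> nat \<Rightarrow> nat" where
  "last_argmax g 0 = 0"
| "last_argmax g (Suc k) = (if g (last_argmax g k) \<le> g k then k else last_argmax g k)"

lemma last_argmax_less: "k > 0 \<Longrightarrow> last_argmax g k < k"
  by (induction k) (auto simp: less_Suc_eq)

lemma last_argmax_max: "i < k \<Longrightarrow> g i \<le> g (last_argmax g k)"
  by (induction k) (auto simp: less_Suc_eq intro: order_trans)

definition plurality :: "nat \<Rightarrow> (nat \<Rightarrow> cand) \<Rightarrow> nat set \<Rightarrow> cand" where
  "plurality n h U = h (last_argmax (support h U) n)"

text \<open>\<open>h j i\<close> stands for the first choice of voter \<open>i\<close> in round \<open>j\<close>.\<close>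

fun unserved :: "nat \<Rightarrow> (nat \<Rightarrow> nat \<Rightarrow> cand) \<Rightarrow> nat \<Rightarrow> nat set" where
  "unserved n h 0 = {..<n}"
| "unserved n h (Suc j) = {i \<in> unserved n h j. h j i \<noteq> plurality n (h j) (unserved n h j)}"

definition winner :: "nat \<Rightarrow> (nat \<Rightarrow> nat \<Rightarrow> cand) \<Rightarrow> nat \<Rightarrow> cand" where
  "winner n h j = plurality n (h j) (unserved n h j)"

definition first_choice :: "profile \<Rightarrow> nat \<Rightarrow> nat \<Rightarrow> cand" where
  "first_choice P j i = hd (P ! j ! i)"

text \<open>All earlier rounds are replayed from the history, so neither the horizon nor
  \<open>d\<close> enters.\<close>

definition greedy_rule :: "profile \<Rightarrow> cand" where
  "greedy_rule P = winner (length (P ! 0)) (first_choice P) (length P - 1)"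

lemma plurality_in: "n > 0 \<Longrightarrow> \<exists>i<n. plurality n h U = h i"
  unfolding plurality_def using last_argmax_less by blast

lemma unserved_subset: "unserved n h j \<subseteq> {..<n}"
  by (induction j) auto

lemma unserved_iff: "i \<in> unserved n h T \<longleftrightarrow> i < n \<and> (\<forall>j<T. h j i \<noteq> winner n h j)"
  by (induction T) (auto simp: less_Suc_eq winner_def)

lemma unserved_cong: "(\<And>j'. j' < j \<Longrightarrow> h j' = h' j') \<Longrightarrow> unserved n h j = unserved n h' j"
  by (induction j) auto

text \<open>Used with a profile cut off after round \<open>j\<close>: this is what makes the rule
  online.\<close>

lemma winner_cong: "(\<And>j'. j' \<le> j \<Longrightarrow> h j' = h' j') \<Longrightarrow> winner n h j = winner n h' j"
  using unserved_cong[of j h h' n] by (simp add: winner_def)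

lemma greedy_rule_take:
  assumes "j < length P"
  shows "greedy_rule (take (Suc j) P) = winner (length (P ! 0)) (first_choice P) j"
proof -
  have "winner (length (P ! 0)) (first_choice (take (Suc j) P)) j
      = winner (length (P ! 0)) (first_choice P) j"
    by (rule winner_cong) (simp add: first_choice_def fun_eq_iff)
  then show ?thesis using assms by (simp add: greedy_rule_def)
qed

lemma online_outcome_greedy:
  "j < length P \<Longrightarrow>
    online_outcome greedy_rule P ! j = winner (length (P ! 0)) (first_choice P) j"
  by (simp add: online_outcome_def greedy_rule_take)

lemma first_choice_in_top_set:
  assumes "is_profile n C T P" "j < T" "i < n" "r \<ge> 1"
  shows "first_choice P j i \<in> top_set P j i r"
proof -
  have "set (P ! j ! i) = C" "C \<noteq> {}" using assms by (auto simp: is_profile_def)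
  then obtain x xs where "P ! j ! i = x # xs" by (cases "P ! j ! i") auto
  then show ?thesis using assms(4) by (cases r) (auto simp: first_choice_def top_set_def)
qed

lemma first_choice_in_cands:
  assumes "is_profile n C T P" "j < T" "i < n"
  shows "first_choice P j i \<in> C"
proof -
  have "set (P ! j ! i) = C" using assms by (auto simp: is_profile_def)
  then show ?thesis
    using first_choice_in_top_set[OF assms le_refl] set_take_subset[of 1 "P ! j ! i"]
    by (auto simp: top_set_def)
qed

lemma online_rule_greedy: "online_rule greedy_rule"
  unfolding online_rule_def
proof (intro allI impI)
  fix n C T P assume P: "is_profile n C T P"
  have len: "length P = T" "n > 0" "length (P ! 0) = n" using P by (auto simp: is_profile_def)
  have "online_outcome greedy_rule P ! j \<in> C" if "j < T" for j
  proof -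
    obtain i where "i < n" "winner n (first_choice P) j = first_choice P j i"
      using plurality_in[OF len(2)] unfolding winner_def by blast
    then show ?thesis
      using online_outcome_greedy[of j P] first_choice_in_cands[OF P that] that len by simp
  qed
  then show "is_outcome C T (online_outcome greedy_rule P)"
    using len by (auto simp: is_outcome_def in_set_conv_nth) (simp_all add: online_outcome_def)
qed

section \<open>Geometric decline of the number of unserved voters\<close>

text \<open>Pigeonhole: first choices split the unserved voters into at most \<open>d\<close>
  classes, and the class of the winner is a largest one. Multiplying out keeps the bound in the
  natural numbers.\<close>

lemma card_unserved_Suc:
  assumes d: "card (h j ` {..<n}) \<le> d"
  shows "d * card (unserved n h (Suc j)) \<le> (d - 1) * card (unserved n h j)"
proof (cases "n = 0")
  case True
  then have "unserved n h (Suc j) = {}" using unserved_subset[of n h "Suc j"] by blast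
  then show ?thesis by (metis card.empty mult_zero_right zero_le)
next
  case False
  define U where "U = unserved n h j"
  define w where "w = plurality n (h j) U"
  have "U \<subseteq> {..<n}" unfolding U_def by (rule unserved_subset)
  then have U: "U \<subseteq> {..<n}" "finite U" using finite_subset by auto
  \<comment> \<open>The maximum is over the first choices of all voters, served ones included; these
    cover every class of \<open>U\<close>.\<close>
  have le: "card {i \<in> U. h j i = c} \<le> card {i \<in> U. h j i = w}" if "c \<in> h j ` {..<n}" for c
    using that last_argmax_max[of _ n "support (h j) U"]
    by (auto simp: support_def plurality_def w_def)
  have "card U = card (\<Union>c\<in>h j ` {..<n}. {i \<in> U. h j i = c})"
    using U by (intro arg_cong[of _ _ card]) auto
  also have "\<dots> \<le> (\<Sum>c\<in>h j ` {..<n}. card {i \<in> U. h j i = c})"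
    by (rule card_UN_le) simp
  also have "\<dots> \<le> card (h j ` {..<n}) * card {i \<in> U. h j i = w}"
    using sum_bounded_above[of "h j ` {..<n}", OF le] by simp
  also have "\<dots> \<le> d * card {i \<in> U. h j i = w}" using d by simp
  finally have 1: "card U \<le> d * card {i \<in> U. h j i = w}" .
  have "unserved n h (Suc j) = U - {i \<in> U. h j i = w}" by (auto simp: U_def w_def)
  then have "card (unserved n h (Suc j)) = card U - card {i \<in> U. h j i = w}"
    using U by (simp add: card_Diff_subset)
  then show ?thesis using 1 by (simp add: U_def diff_mult_distrib diff_mult_distrib2)
qed

lemma card_unserved:
  assumes d: "d \<ge> 1" and h: "\<And>j. j < T \<Longrightarrow> card (h j ` {..<n}) \<le> d"
  shows "real (card (unserved n h T)) \<le> real n * (1 - 1 / real d) ^ T"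
  using h
proof (induction T)
  case (Suc T)
  have IH: "real (card (unserved n h T)) \<le> real n * (1 - 1 / real d) ^ T"
    by (rule Suc.IH) (simp add: Suc.prems)
  have "real (d * card (unserved n h (Suc T))) \<le> real ((d - 1) * card (unserved n h T))"
    using card_unserved_Suc[of h T n d] Suc.prems[of T] of_nat_le_iff by blast
  then have "real (card (unserved n h (Suc T))) \<le> (1 - 1 / real d) * real (card (unserved n h T))"
    using d by (simp add: field_simps of_nat_diff del: unserved.simps)
  \<comment> \<open>Monotonicity applies because \<open>d \<ge> 1\<close> makes the factor
    nonnegative.\<close>
  also have "\<dots> \<le> (1 - 1 / real d) * (real n * (1 - 1 / real d) ^ T)"
    using d by (intro mult_left_mono IH) simp
  finally show ?case by (simp add: ac_simps)
qed simp

lemma greedy_all_rank_JR: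
  assumes P: "is_profile n C T P" and fc: "at_most_first_choices d n P" and d: "d \<ge> 1"
    and small: "real T * (1 - 1 / real d) ^ T < 1"
  shows "all_rank_JR n C T P (online_outcome greedy_rule P)"
  unfolding all_rank_JR_def
proof (intro allI impI, elim conjE, rule ccontr)
  let ?W = "online_outcome greedy_rule P"
  fix R S k
  assume R: "rank_matrix (card C) T n R" and S: "group n S"
    and k: "k = card {j. j < T \<and> agrees P R S j}" "k > 0"
    and size: "real (card S) \<ge> real n / real k"
    and nrep: "\<not> (\<exists>j<T. represented P R ?W S j)"
  have len: "length P = T" "n \<ge> 1" "T \<ge> 1" "length (P ! 0) = n"
    using P by (auto simp: is_profile_def)
  let ?U = "unserved n (first_choice P) T"
  have "S \<subseteq> ?U"
  proof
    fix i assume i: "i \<in> S"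
    then have "i < n" using S by (auto simp: group_def)
    moreover have "first_choice P j i \<noteq> winner n (first_choice P) j" if "j < T" for j
    proof -
      have "first_choice P j i \<in> top_set P j i (R j i)"
        using first_choice_in_top_set[OF P that \<open>i < n\<close>] R that \<open>i < n\<close>
        by (simp add: rank_matrix_def)
      then show ?thesis
        using nrep that i len online_outcome_greedy[of j P] by (auto simp: represented_def)
    qed
    ultimately show "i \<in> ?U" by (simp add: unserved_iff)
  qed
  then have "real (card S) \<le> real (card ?U)"
    using card_mono[of ?U S] finite_subset[OF unserved_subset] by simp
  also have "\<dots> \<le> real n * (1 - 1 / real d) ^ T"
  proof (rule card_unserved[OF d])
    fix j assume "j < T"
    moreover have "first_choice P j ` {..<n} = first_choices n P j"
      by (auto simp: first_choice_def first_choices_def)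
    ultimately show "card (first_choice P j ` {..<n}) \<le> d"
      using fc len by (simp add: at_most_first_choices_def)
  qed
  also have "\<dots> < real n / real T"
    using small len by (simp add: field_simps)
  \<comment> \<open>Since \<open>k\<close> counts rounds, agreement in all \<open>T\<close> rounds
    gives the smallest size threshold.\<close>
  also have "\<dots> \<le> real n / real k"
  proof -
    have "k \<le> card {..<T}" unfolding k by (rule card_mono) auto
    then show ?thesis using k(2) by (intro divide_left_mono) auto
  qed
  finally show False using size by simp
qed


section \<open>Cyclic profiles\<close>

lemma nth_notin_take: "distinct xs \<Longrightarrow> p < length xs \<Longrightarrow> xs ! p \<notin> set (take p xs)"
  by (auto simp: in_set_conv_nth nth_eq_iff_index_eq)

lemma nth_in_take: "q < p \<Longrightarrow> p \<le> length xs \<Longrightarrow> xs ! q \<in> set (take p xs)"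
  by (auto simp: in_set_conv_nth intro!: exI[of _ q])

text \<open>In the order \<open>a, a + 1, ...\<close> modulo \<open>d\<close>, candidate
  \<open>w\<close> has 0-based position \<open>w - a\<close> modulo \<open>d\<close>; adding
  \<open>d\<close> first keeps truncated subtraction exact.\<close>

lemma rotate_upt_nth:
  assumes "a < d" "w < d"
  shows "rotate a [0..<d] ! ((w + d - a) mod d) = w"
proof -
  have "(a + (w + d - a) mod d) mod d = (a + (w + d - a)) mod d"
    by (rule mod_add_right_eq)
  also have "\<dots> = w" using assms by simp
  finally show ?thesis using assms by (simp add: nth_rotate)
qed

text \<open>Position 0 is held by \<open>a\<close>. This makes the position of a winner other than
  \<open>a\<close> a legal rank.\<close>

lemma rotate_upt_position_pos:
  fixes a w d :: nat
  assumes "a < d" "w < d" "a \<noteq> w"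
  shows "0 < (w + d - a) mod d"
proof (rule ccontr)
  assume "\<not> 0 < (w + d - a) mod d"
  then have "rotate a [0..<d] ! 0 = w" using rotate_upt_nth[OF assms(1,2)] by simp
  then show False using assms by (simp add: nth_rotate)
qed

text \<open>The candidate directly above \<open>w\<close> does not depend on \<open>a\<close>; the
  voters who miss their first choice \<open>a\<close> can therefore agree on it.\<close>

lemma rotate_upt_pred_nth:
  assumes "a < d" "w < d" "a \<noteq> w"
  shows "rotate a [0..<d] ! ((w + d - a) mod d - 1) = (w + d - 1) mod d"
proof -
  let ?p = "(w + d - a) mod d"
  have p: "0 < ?p" "?p < d" using rotate_upt_position_pos[OF assms] assms by auto
  have "(a + ?p) mod d = w" using rotate_upt_nth[OF assms(1,2)] p by (simp add: nth_rotate)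
  then have "(w + (d - 1)) mod d = (a + ?p + (d - 1)) mod d" by (metis mod_add_left_eq)
  also have "a + ?p + (d - 1) = a + (?p - 1) + d" using p by simp
  also have "\<dots> mod d = (a + (?p - 1)) mod d" by simp
  finally have "(w + d - 1) mod d = (a + (?p - 1)) mod d" using assms by simp
  moreover have "?p - 1 < length [0..<d]" using p by simp
  ultimately show ?thesis using assms by (simp add: nth_rotate del: One_nat_def)
qed

text \<open>\<open>e\<close> numbers the functions from rounds to \<open>{..<d}\<close>: voter \<open>v\<close> has type \<open>e v j\<close> in round \<open>j\<close>.\<close>

definition cyclic_profile :: "nat \<Rightarrow> nat \<Rightarrow> (nat \<Rightarrow> nat \<Rightarrow> nat) \<Rightarrow> profile" where
  "cyclic_profile d T e =
     map (\<lambda>j. map (\<lambda>v. rotate (e v j) [0..<d]) [0..<d ^ T]) [0..<T]"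

lemma cyclic_profile_nth:
  "j < T \<Longrightarrow> v < d ^ T \<Longrightarrow> cyclic_profile d T e ! j ! v = rotate (e v j) [0..<d]"
  by (simp add: cyclic_profile_def)

section \<open>Failure of all-rank-wJR on cyclic profiles\<close>

lemma is_profile_cyclic:
  assumes "d \<ge> 1" "T \<ge> 1"
  shows "is_profile (d ^ T) {..<d} T (cyclic_profile d T e)"
  using assms by (auto simp: is_profile_def cyclic_profile_def lessThan_empty_iff)

lemma at_most_first_choices_cyclic:
  assumes "d \<ge> 1"
  shows "at_most_first_choices d (d ^ T) (cyclic_profile d T e)"
  unfolding at_most_first_choices_def
proof (intro allI impI)
  fix j assume "j < length (cyclic_profile d T e)"
  then have j: "j < T" by (simp add: cyclic_profile_def)
  have "first_choices (d ^ T) (cyclic_profile d T e) j \<subseteq> {..<d}"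
  proof
    fix c assume "c \<in> first_choices (d ^ T) (cyclic_profile d T e) j"
    then obtain v where "v < d ^ T" and c: "c = hd (cyclic_profile d T e ! j ! v)"
      by (auto simp: first_choices_def)
    then have "c = hd (rotate (e v j) [0..<d])" using j by (simp add: cyclic_profile_nth)
    moreover have "rotate (e v j) [0..<d] \<noteq> []" using assms by simp
    ultimately have "c \<in> set (rotate (e v j) [0..<d])" using hd_in_set by metis
    then show "c \<in> {..<d}" by simp
  qed
  then show "card (first_choices (d ^ T) (cyclic_profile d T e) j) \<le> d"
    using card_mono[of "{..<d}"] by fastforce
qed

lemma cyclic_profile_no_wJR:
  assumes T: "T \<ge> 1" and large: "real T * (1 - 1 / real d) ^ T \<ge> 1" and d: "d \<ge> 1"
    and e: "bij_betw e {0..<d ^ T} (PiE {..<T} (\<lambda>_. {..<d}))"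
    and W: "is_outcome {..<d} T W"
  shows "\<not> all_rank_wJR (d ^ T) {..<d} T (cyclic_profile d T e) W"
proof
  let ?P = "cyclic_profile d T e"
  assume JR: "all_rank_wJR (d ^ T) {..<d} T ?P W"
  \<comment> \<open>For \<open>d = 1\<close> the base \<open>1 - 1/d\<close> is 0, contradicting
    \<open>large\<close>. With \<open>d \<ge> 2\<close> the group \<open>S\<close> below is
    nonempty.\<close>
  have d2: "d \<ge> 2"
  proof (rule ccontr)
    assume "\<not> d \<ge> 2"
    then have "d = 1" using d by simp
    then show False using large T by (simp add: power_0_left)
  qed
  have Wd: "W ! j < d" if "j < T" for j
  proof -
    have "W ! j \<in> set W" using W that by (simp add: is_outcome_def)
    then show ?thesis using W by (auto simp: is_outcome_def)
  qed
  have ed: "e v j < d" if "v < d ^ T" "j < T" for v j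
    using bij_betwE[OF e] that by (auto dest!: bspec[of _ _ v] simp: PiE_iff)
  define S where "S = {v. v < d ^ T \<and> (\<forall>j<T. e v j \<noteq> W ! j)}"
  \<comment> \<open>The 0-based position of the winner, read as a rank, cuts the ranking just above
    the winner; voters outside \<open>S\<close> get an arbitrary legal rank.\<close>
  define R where "R j v = (if v \<in> S then (W ! j + d - e v j) mod d else 1)" for j v
  \<comment> \<open>\<open>e\<close> identifies \<open>S\<close> with the functions that avoid the
    winner in every round, which leaves \<open>d - 1\<close> values per round.\<close>
  have "bij_betw e S (PiE {..<T} (\<lambda>j. {..<d} - {W ! j}))"
  proof (rule bij_betw_subset[OF e])
    show "S \<subseteq> {0..<d ^ T}" by (auto simp: S_def)
    show "e ` S = PiE {..<T} (\<lambda>j. {..<d} - {W ! j})"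
    proof
      show "e ` S \<subseteq> PiE {..<T} (\<lambda>j. {..<d} - {W ! j})"
        using bij_betwE[OF e] by (fastforce simp: S_def PiE_iff)
      show "PiE {..<T} (\<lambda>j. {..<d} - {W ! j}) \<subseteq> e ` S"
      proof
        fix g assume g: "g \<in> PiE {..<T} (\<lambda>j. {..<d} - {W ! j})"
        then have "g \<in> PiE {..<T} (\<lambda>_. {..<d})" by (auto simp: PiE_iff)
        then have "g \<in> e ` {0..<d ^ T}" using bij_betw_imp_surj_on[OF e] by simp
        then obtain v where "v < d ^ T" "g = e v" by auto
        then show "g \<in> e ` S" using g by (auto simp: S_def PiE_iff)
      qed
    qed
  qed
  then have "card S = card (PiE {..<T} (\<lambda>j. {..<d} - {W ! j}))" by (rule bij_betw_same_card)
  also have "\<dots> = (d - 1) ^ T" using Wd by (simp add: card_PiE)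
  finally have cardS: "card S = (d - 1) ^ T" .
  have "1 - 1 / real d = real (d - 1) / real d" using d2 by (simp add: field_simps of_nat_diff)
  then have "(1 - 1 / real d) ^ T = real (card S) / real (d ^ T)"
    by (simp add: cardS power_divide)
  then have size: "real (card S) \<ge> real (d ^ T) / real T"
    using large T d2 by (simp add: field_simps)
  have pos: "0 < R j v" "R j v < d" if "v \<in> S" "j < T" for v j
    using rotate_upt_position_pos[of "e v j" d "W ! j"] that Wd[OF that(2)] ed[of v j] d2
    by (auto simp: R_def S_def)
  have "rank_matrix (card {..<d}) T (d ^ T) R"
    unfolding rank_matrix_def
  proof (intro allI impI)
    fix j v assume "j < T" "v < d ^ T"
    then show "1 \<le> R j v \<and> R j v \<le> card {..<d}"
      using pos[of v j] d2 by (cases "v \<in> S") (auto simp: R_def[of _ v])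
  qed
  moreover have "group (d ^ T) S"
  proof -
    have "card S \<noteq> 0" using cardS d2 by simp
    then have "S \<noteq> {}" by auto
    moreover have "S \<subseteq> {..<d ^ T}" by (auto simp: S_def)
    ultimately show ?thesis by (simp add: group_def)
  qed
  moreover have "agrees ?P R S j" if j: "j < T" for j
  proof -
    \<comment> \<open>Position \<open>R j v - 1\<close> is the last one inside the cut, and for
      every \<open>v\<close> in \<open>S\<close> it holds the cyclic predecessor of the
      winner.\<close>
    have "(W ! j + d - 1) mod d \<in> top_set ?P j v (R j v)" if v: "v \<in> S" for v
    proof -
      have *: "v < d ^ T" "e v j \<noteq> W ! j" using v j by (auto simp: S_def)
      have "rotate (e v j) [0..<d] ! (R j v - 1) = (W ! j + d - 1) mod d"
        using rotate_upt_pred_nth[OF ed[OF *(1) j] Wd[OF j] *(2)] v by (simp add: R_def)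
      then show ?thesis
        using nth_in_take[of "R j v - 1" "R j v" "rotate (e v j) [0..<d]"] pos[OF v j] * j
        by (simp add: top_set_def cyclic_profile_nth)
    qed
    then show ?thesis by (auto simp: agrees_def)
  qed
  ultimately obtain j where j: "j < T" "represented ?P R W S j"
    using JR size unfolding all_rank_wJR_def by blast
  then obtain v where v: "v \<in> S" "W ! j \<in> top_set ?P j v (R j v)" by (auto simp: represented_def)
  have *: "v < d ^ T" using v by (auto simp: S_def)
  \<comment> \<open>The winner stands at the first position outside the cut.\<close>
  have "rotate (e v j) [0..<d] ! R j v = W ! j"
    using rotate_upt_nth[OF ed[OF * j(1)] Wd[OF j(1)]] v by (simp add: R_def)
  then show False
    using nth_notin_take[of "rotate (e v j) [0..<d]" "R j v"] pos[OF v(1) j(1)] v(2) * j(1)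
    by (simp add: top_set_def cyclic_profile_nth)
qed

lemma ex_profile_no_wJR:
  assumes "d \<ge> 1" "T \<ge> 1" "real T * (1 - 1 / real d) ^ T \<ge> 1"
  shows "\<exists>n C P. is_profile n C T P \<and> at_most_first_choices d n P \<and>
    \<not> (\<exists>W. is_outcome C T W \<and> all_rank_wJR n C T P W)"
proof -
  have "finite (PiE {..<T} (\<lambda>_. {..<d}))" by (simp add: finite_PiE)
  from ex_bij_betw_nat_finite[OF this]
  obtain e where "bij_betw e {0..<d ^ T} (PiE {..<T} (\<lambda>_. {..<d}))"
    by (auto simp: card_PiE)
  then show ?thesis
    using assms is_profile_cyclic at_most_first_choices_cyclic cyclic_profile_no_wJR by meson
qed

text \<open>Agreement in every round is the case \<open>k = T\<close>.\<close>

lemma all_rank_JR_imp_wJR: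
  assumes "T \<ge> 1" "all_rank_JR n C T P W"
  shows "all_rank_wJR n C T P W"
  unfolding all_rank_wJR_def
proof (intro allI impI)
  fix R S
  assume *: "rank_matrix (card C) T n R \<and> group n S \<and>
    (\<forall>j<T. agrees P R S j) \<and> real (card S) \<ge> real n / real T"
  then have "{j. j < T \<and> agrees P R S j} = {..<T}" by auto
  then have "card {j. j < T \<and> agrees P R S j} = T" by simp
  then show "\<exists>j<T. represented P R W S j"
    using assms(2)[unfolded all_rank_JR_def, rule_format, of R S T] assms(1) * by simp
qed


section \<open>Time-bounded correctness of programs\<close>

abbreviation seq_com :: "com \<Rightarrow> com \<Rightarrow> com" (infixr ";;" 60) where
  "c1 ;; c2 \<equiv> Seq c1 c2"

text \<open>Total correctness with a time budget. As \<open>B\<close> is only an upper bound,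
  branches of different cost can share it.\<close>

definition runs :: "com \<Rightarrow> state \<Rightarrow> nat \<Rightarrow> (state \<Rightarrow> bool) \<Rightarrow> bool" where
  "runs c s B Q \<longleftrightarrow> (\<exists>t s'. exec c s t s' \<and> t \<le> B \<and> Q s')"

lemma runs_mono:
  "runs c s B Q \<Longrightarrow> B \<le> B' \<Longrightarrow> (\<And>s'. Q s' \<Longrightarrow> Q' s') \<Longrightarrow> runs c s B' Q'"
  unfolding runs_def by (meson le_trans)

lemma runs_Const: "B \<ge> 1 \<Longrightarrow> Q (r(a := v), m) \<Longrightarrow> runs (Const a v) (r, m) B Q"
  and runs_Add: "B \<ge> 1 \<Longrightarrow> Q (r(a := r b + r c), m) \<Longrightarrow> runs (Add a b c) (r, m) B Q"
  and runs_Sub: "B \<ge> 1 \<Longrightarrow> Q (r(a := r b - r c), m) \<Longrightarrow> runs (Sub a b c) (r, m) B Q"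
  and runs_Load: "B \<ge> 1 \<Longrightarrow> Q (r(a := m (r b)), m) \<Longrightarrow> runs (Load a b) (r, m) B Q"
  and runs_Store: "B \<ge> 1 \<Longrightarrow> Q (r, m(r a := r b)) \<Longrightarrow> runs (Store a b) (r, m) B Q"
  unfolding runs_def by (blast intro: exec.intros)+

lemma runs_Seq:
  assumes "runs c1 s B1 Q1" "\<And>s'. Q1 s' \<Longrightarrow> runs c2 s' (B - B1) Q" "B1 \<le> B"
  shows "runs (c1 ;; c2) s B Q"
proof -
  obtain t1 s' where 1: "exec c1 s t1 s'" "t1 \<le> B1" "Q1 s'" using assms(1) by (auto simp: runs_def)
  obtain t2 s'' where 2: "exec c2 s' t2 s''" "t2 \<le> B - B1" "Q s''"
    using assms(2)[OF 1(3)] by (auto simp: runs_def)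
  show ?thesis unfolding runs_def
    using exec.Seq[OF 1(1) 2(1)] 1 2 assms(3) by (intro exI[of _ "t1 + t2"] exI[of _ s'']) simp
qed

text \<open>Symbolic execution: a leading instruction is carried out on the state in the goal, and
  one step is deducted from the budget.\<close>

lemma runs_Seq_step:
  "B \<ge> 1 \<Longrightarrow> runs c (r(a := v), m) (B - 1) Q \<Longrightarrow> runs (Const a v ;; c) (r, m) B Q"
  "B \<ge> 1 \<Longrightarrow> runs c (r(a := r b + r b'), m) (B - 1) Q \<Longrightarrow> runs (Add a b b' ;; c) (r, m) B Q"
  "B \<ge> 1 \<Longrightarrow> runs c (r(a := r b - r b'), m) (B - 1) Q \<Longrightarrow> runs (Sub a b b' ;; c) (r, m) B Q"
  "B \<ge> 1 \<Longrightarrow> runs c (r(a := m (r b)), m) (B - 1) Q \<Longrightarrow> runs (Load a b ;; c) (r, m) B Q"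
  "B \<ge> 1 \<Longrightarrow> runs c (r, m(r a := r b)) (B - 1) Q \<Longrightarrow> runs (Store a b ;; c) (r, m) B Q"
  by (rule runs_Seq[where ?B1.0 = 1 and ?Q1.0 = "(=) _"],
      rule runs_Const runs_Add runs_Sub runs_Load runs_Store, simp, rule refl, auto)+

lemma exec_Seq_iff:
  "exec (c1 ;; c2) s t s' \<longleftrightarrow> (\<exists>t1 s1 t2. exec c1 s t1 s1 \<and> exec c2 s1 t2 s' \<and> t = t1 + t2)"
proof
  assume "exec (c1 ;; c2) s t s'"
  then show "\<exists>t1 s1 t2. exec c1 s t1 s1 \<and> exec c2 s1 t2 s' \<and> t = t1 + t2"
    by cases blast
qed (auto intro: exec.Seq)

text \<open>Restores right-nested sequences when a branch that is itself a sequence is put before a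
  continuation.\<close>

lemma runs_Seq_assoc: "runs (c1 ;; (c2 ;; c3)) s B Q \<Longrightarrow> runs ((c1 ;; c2) ;; c3) s B Q"
  unfolding runs_def exec_Seq_iff by (metis add.assoc)

lemma runs_If:
  assumes "B \<ge> 1" "r a \<noteq> 0 \<Longrightarrow> runs c1 (r, m) (B - 1) Q" "r a = 0 \<Longrightarrow> runs c2 (r, m) (B - 1) Q"
  shows "runs (com.If a c1 c2) (r, m) B Q"
proof (cases "r a = 0")
  case True
  then obtain t s' where "exec c2 (r, m) t s'" "t \<le> B - 1" "Q s'"
    using assms(3) by (auto simp: runs_def)
  then show ?thesis unfolding runs_def using exec.IfFalse[of r a, OF True] assms(1)
    by (intro exI[of _ "t + 1"] exI[of _ s']) auto
next
  case False
  then obtain t s' where "exec c1 (r, m) t s'" "t \<le> B - 1" "Q s'"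
    using assms(2) by (auto simp: runs_def)
  then show ?thesis unfolding runs_def using exec.IfTrue[of r a, OF False] assms(1)
    by (intro exI[of _ "t + 1"] exI[of _ s']) auto
qed

text \<open>Moving the continuation into both branches avoids an assertion at their join.\<close>

lemma runs_If_Seq:
  assumes "B \<ge> 1" "r a \<noteq> 0 \<Longrightarrow> runs (c1 ;; c) (r, m) (B - 1) Q"
    "r a = 0 \<Longrightarrow> runs (c2 ;; c) (r, m) (B - 1) Q"
  shows "runs (com.If a c1 c2 ;; c) (r, m) B Q"
proof -
  show ?thesis
  proof (cases "r a = 0")
    case True
    then obtain t1 s1 t2 s' where 1: "exec c2 (r, m) t1 s1" "exec c s1 t2 s'" "t1 + t2 \<le> B - 1" "Q s'"
      using assms(3) by (auto simp: runs_def exec_Seq_iff)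
    then show ?thesis unfolding runs_def using exec.Seq[OF exec.IfFalse[of r a, OF True 1(1)] 1(2)] assms(1)
      by (intro exI[of _ "t1 + 1 + t2"] exI[of _ s']) auto
  next
    case False
    then obtain t1 s1 t2 s' where 1: "exec c1 (r, m) t1 s1" "exec c s1 t2 s'" "t1 + t2 \<le> B - 1" "Q s'"
      using assms(2) by (auto simp: runs_def exec_Seq_iff)
    then show ?thesis unfolding runs_def using exec.Seq[OF exec.IfTrue[of r a, OF False 1(1)] 1(2)] assms(1)
      by (intro exI[of _ "t1 + 1 + t2"] exI[of _ s']) auto
  qed
qed

lemmas runs_intros =
  runs_Const runs_Add runs_Sub runs_Load runs_Store runs_If runs_Seq_step runs_Seq_assoc runs_If_Seq

text \<open>\<open>I i\<close> describes the state after \<open>i\<close> iterations. Each iteration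
  costs the body and one test; the final failing test adds 1.\<close>

lemma runs_While:
  assumes step: "\<And>i r m. i < N \<Longrightarrow> I i (r, m) \<Longrightarrow> r a \<noteq> 0 \<and> runs c (r, m) B (I (Suc i))"
    and stop: "\<And>r m. I N (r, m) \<Longrightarrow> r a = 0"
    and init: "I 0 s"
  shows "runs (While a c) s (N * (B + 1) + 1) (I N)"
proof -
  \<comment> \<open>Induction on the number \<open>k\<close> of remaining iterations.\<close>
  have "runs (While a c) s (k * (B + 1) + 1) (I N)" if "k \<le> N" "I (N - k) s" for k s
    using that
  proof (induction k arbitrary: s)
    case 0
    obtain r m where s: "s = (r, m)" by fastforce
    then show ?case using 0 exec.WhileFalse[of r a c m] stop[of r m] unfolding runs_def by auto
  next
    case (Suc k)
    obtain r m where s: "s = (r, m)" by fastforce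
    have N: "N - Suc k < N" "Suc (N - Suc k) = N - k" using Suc.prems by auto
    have "r a \<noteq> 0" "runs c (r, m) B (I (N - k))"
      using step[OF N(1), of r m] N(2) Suc.prems(2) s by auto
    then obtain t1 s1 where 1: "exec c (r, m) t1 s1" "t1 \<le> B" "I (N - k) s1"
      by (auto simp: runs_def)
    obtain t2 s2 where 2: "exec (While a c) s1 t2 s2" "t2 \<le> k * (B + 1) + 1" "I N s2"
      using Suc.IH[of s1] 1 Suc.prems by (auto simp: runs_def)
    show ?case unfolding runs_def s
      using exec.WhileTrue[of r a, OF \<open>r a \<noteq> 0\<close> 1(1) 2(1)] 1 2
      by (intro exI[of _ "t1 + t2 + 1"] exI[of _ s2]) auto
  qed
  from this[of N s] init show ?thesis by simp
qed

section \<open>A program for the greedy rule\<close>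

text \<open>
  Registers: 0 winner, 1 rounds left, 2 number \<open>n\<close> of voters, 3 number \<open>m\<close> of candidates,
  4 address of the first voter's ranking in the current round, 5 address \<open>b\<close> behind the input,
  6 the constant 1, 7 and 8 counter and address of the candidate under consideration,
  9 best support so far, 10 candidate under consideration, 11 the constant 0 (never written),
  12 support being counted, 13 and 14 addresses of the ranking and the flag of a voter,
  15 counter, 16 and 17 scratch; 8 and 9 also serve as counters while \<open>b\<close> is computed. The cells
  \<open>b, \<dots>, b + n - 1\<close> beyond the input hold the flags: 1 for voters who have already received a
  first choice. First choices lie \<open>m\<close> cells apart, so addresses are advanced by addition and no
  multiplication is needed.
\<close>

definition size_loop :: com where
  "size_loop = While 8 (Add 9 2 11 ;; While 9 (Add 5 5 3 ;; Sub 9 9 6) ;; Sub 8 8 6)"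

text \<open>The product arises by adding \<open>m\<close> once for each of the \<open>T * n\<close>
  rankings. As register 11 holds 0, \<open>Add a b 11\<close> copies register \<open>b\<close> to
  register \<open>a\<close>.\<close>

lemma runs_size_loop:
  assumes r: "r 5 = b" "r 8 = T" "r 2 = n" "r 3 = m" "r 6 = 1" "r 11 = 0"
  shows "runs size_loop (r, \<mu>) (T * (n * 3 + 4) + 1)
    (\<lambda>(r', \<mu>'). \<mu>' = \<mu> \<and> (\<forall>a. a \<notin> {5, 8, 9} \<longrightarrow> r' a = r a) \<and> r' 5 = b + T * n * m)"
proof -
  define I where "I j s = (case s of (r', \<mu>') \<Rightarrow> \<mu>' = \<mu> \<and>
    (\<forall>a. a \<notin> {5, 8, 9} \<longrightarrow> r' a = r a) \<and> r' 5 = b + j * n * m \<and> r' 8 = T - j)" for j s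
  have "runs size_loop (r, \<mu>) (T * (n * 3 + 3 + 1) + 1) (I T)"
    unfolding size_loop_def
  proof (rule runs_While)
    show "I 0 (r, \<mu>)" using r by (simp add: I_def)
    show "r' 8 = 0" if "I T (r', \<mu>')" for r' \<mu>' using that by (simp add: I_def)
    fix j r1 \<mu>1 assume j: "j < T" and I: "I j (r1, \<mu>1)"
    define J where "J i s = (case s of (r', \<mu>') \<Rightarrow> \<mu>' = \<mu> \<and>
      (\<forall>a. a \<notin> {5, 8, 9} \<longrightarrow> r' a = r a) \<and> r' 5 = b + j * n * m + i * m \<and>
      r' 8 = T - j \<and> r' 9 = n - i)" for i s
    have "runs (While 9 (Add 5 5 3 ;; Sub 9 9 6)) (r1(9 := n), \<mu>1) (n * (2 + 1) + 1) (J n)"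
    proof (rule runs_While)
      show "J 0 (r1(9 := n), \<mu>1)" using I by (simp add: I_def J_def)
      show "r' 9 = 0" if "J n (r', \<mu>')" for r' \<mu>' using that by (simp add: J_def)
      fix i r2 \<mu>2 assume i: "i < n" and J: "J i (r2, \<mu>2)"
      show "r2 9 \<noteq> 0 \<and> runs (Add 5 5 3 ;; Sub 9 9 6) (r2, \<mu>2) 2 (J (Suc i))"
        using i J r by (intro conjI runs_intros) (auto simp: J_def)
    qed
    then show "r1 8 \<noteq> 0 \<and> runs (Add 9 2 11 ;; While 9 (Add 5 5 3 ;; Sub 9 9 6) ;; Sub 8 8 6)
        (r1, \<mu>1) (n * 3 + 3) (I (Suc j))"
      using j I r
      apply (intro conjI runs_intros)
      apply (simp add: I_def)
      apply simp
      apply (rule runs_Seq)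
      apply (simp add: I_def)
      apply (clarsimp simp: J_def)
      apply (intro runs_intros)
      apply (auto simp: I_def algebra_simps)
      done
  qed
  then show ?thesis by (rule runs_mono) (auto simp: I_def)
qed

lemma card_less_Suc:
  "card {i'. i' < Suc i \<and> A i'} = card {i'. i' < i \<and> A i'} + (if A i then 1 else 0)"
proof -
  have "{i'. i' < Suc i \<and> A i'} = (if A i then insert i {i'. i' < i \<and> A i'} else {i'. i' < i \<and> A i'})"
    by (auto simp: less_Suc_eq)
  then show ?thesis by simp
qed

text \<open>With truncated subtraction, \<open>(x - y) + (y - x)\<close> is 0 exactly if
  \<open>x = y\<close>; this is the equality test. \<open>Const 17 0\<close> on a scratch register
  serves as a no-op.\<close>

definition count_loop :: com where
  "count_loop = While 15 (
     Load 16 14 ;;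
     com.If 16 (Const 17 0)
       (Load 16 13 ;; Sub 17 16 10 ;; Sub 16 10 16 ;; Add 17 17 16 ;;
        com.If 17 (Const 17 0) (Add 12 12 6)) ;;
     Add 13 13 3 ;; Add 14 14 6 ;; Sub 15 15 6)"

lemma runs_count_loop:
  assumes r: "r 3 = m" "r 6 = 1" "r 12 = 0" "r 13 = p" "r 14 = b" "r 15 = n"
    and g: "\<And>i. i < n \<Longrightarrow> \<mu> (p + i * m) = g i"
    and U: "\<And>i. i < n \<Longrightarrow> \<mu> (b + i) = (if i \<in> U then 0 else 1)" "U \<subseteq> {..<n}"
  shows "runs count_loop (r, \<mu>) (n * 13 + 1)
    (\<lambda>(r', \<mu>'). \<mu>' = \<mu> \<and> (\<forall>a<12. r' a = r a) \<and> r' 12 = card {i \<in> U. g i = r 10})"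
proof -
  define I where "I i s = (case s of (r', \<mu>') \<Rightarrow> \<mu>' = \<mu> \<and> (\<forall>a<12. r' a = r a) \<and>
    r' 12 = card {i'. i' < i \<and> i' \<in> U \<and> g i' = r 10} \<and>
    r' 13 = p + i * m \<and> r' 14 = b + i \<and> r' 15 = n - i)" for i s
  have "runs count_loop (r, \<mu>) (n * (12 + 1) + 1) (I n)"
    unfolding count_loop_def
  proof (rule runs_While)
    show "I 0 (r, \<mu>)" using r by (simp add: I_def)
    show "r' 15 = 0" if "I n (r', \<mu>')" for r' \<mu>' using that by (simp add: I_def)
    fix i r1 \<mu>1 assume i: "i < n" and I: "I i (r1, \<mu>1)"
    have *: "\<mu>1 = \<mu>" "r1 3 = m" "r1 6 = 1" "r1 10 = r 10" "\<forall>a<12. r1 a = r a"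
      "r1 12 = card {i'. i' < i \<and> i' \<in> U \<and> g i' = r 10}"
      "r1 13 = p + i * m" "r1 14 = b + i" "r1 15 = n - i"
      using I r by (auto simp: I_def)
    show "r1 15 \<noteq> 0 \<and> runs (Load 16 14 ;;
      com.If 16 (Const 17 0)
        (Load 16 13 ;; Sub 17 16 10 ;; Sub 16 10 16 ;; Add 17 17 16 ;;
         com.If 17 (Const 17 0) (Add 12 12 6)) ;;
      Add 13 13 3 ;; Add 14 14 6 ;; Sub 15 15 6) (r1, \<mu>1) 12 (I (Suc i))"
      using i by (intro conjI runs_intros)
        (auto simp: I_def * g U(1) card_less_Suc split: if_splits)
  qed
  moreover have "{i'. i' < n \<and> i' \<in> U \<and> g i' = r 10} = {i \<in> U. g i = r 10}" using U(2) by auto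
  ultimately show ?thesis by (elim runs_mono) (auto simp: I_def)
qed

text \<open>The first choice of every voter is tried, served or not. \<open>Sub 16 9 12\<close>
  gives 0 when the old best is at most the new support, so ties go to the later voter as in
  \<open>last_argmax\<close>.\<close>

definition pick_loop :: com where
  "pick_loop = While 7 (
     Load 10 8 ;; Const 12 0 ;; Add 13 4 11 ;; Add 14 5 11 ;; Add 15 2 11 ;;
     count_loop ;;
     Sub 16 9 12 ;; com.If 16 (Const 17 0) (Add 0 10 11 ;; Add 9 12 11) ;;
     Add 8 8 3 ;; Sub 7 7 6)"

lemma runs_pick_loop:
  assumes r: "r 2 = n" "r 3 = m" "r 4 = p" "r 5 = b" "r 6 = 1" "r 7 = n" "r 8 = p" "r 9 = 0"
      "r 11 = 0"
    and g: "\<And>i. i < n \<Longrightarrow> \<mu> (p + i * m) = g i"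
    and U: "\<And>i. i < n \<Longrightarrow> \<mu> (b + i) = (if i \<in> U then 0 else 1)" "U \<subseteq> {..<n}"
    and n: "n > 0"
  shows "runs pick_loop (r, \<mu>) (n * (n * 13 + 21) + 1)
    (\<lambda>(r', \<mu>'). \<mu>' = \<mu> \<and> (\<forall>a\<in>{1..6} \<union> {11}. r' a = r a) \<and> r' 0 = plurality n g U)"
proof -
  \<comment> \<open>The initial 0 in register 9 is not a support; it ensures that voter 0 is
    accepted even with support 0. Register 0 is meaningful only from then on.\<close>
  define I where "I i s = (case s of (r', \<mu>') \<Rightarrow> \<mu>' = \<mu> \<and> (\<forall>a\<in>{1..6} \<union> {11}. r' a = r a) \<and>
    r' 7 = n - i \<and> r' 8 = p + i * m \<and>
    r' 9 = (if i = 0 then 0 else support g U (last_argmax (support g U) i)) \<and>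
    (i > 0 \<longrightarrow> r' 0 = g (last_argmax (support g U) i)))" for i s
  have "runs pick_loop (r, \<mu>) (n * (n * 13 + 20 + 1) + 1) (I n)"
    unfolding pick_loop_def
  proof (rule runs_While)
    show "I 0 (r, \<mu>)" using r by (simp add: I_def)
    show "r' 7 = 0" if "I n (r', \<mu>')" for r' \<mu>' using that by (simp add: I_def)
    fix i r1 \<mu>1 assume i: "i < n" and I: "I i (r1, \<mu>1)"
    have *: "\<mu>1 = \<mu>" "r1 2 = n" "r1 3 = m" "r1 4 = p" "r1 5 = b" "r1 6 = 1" "r1 11 = 0"
      "r1 7 = n - i" "r1 8 = p + i * m"
      using I r by (auto simp: I_def)
    define r2 where "r2 = r1(10 := g i, 12 := 0, 13 := p, 14 := b, 15 := n)"
    have count: "runs count_loop (r2, \<mu>) (n * 13 + 1) (\<lambda>(r', \<mu>'). \<mu>' = \<mu> \<and>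
        (\<forall>a<12. r' a = r2 a) \<and> r' 12 = card {i' \<in> U. g i' = r2 10})"
      by (rule runs_count_loop) (auto simp: r2_def * g U(1) dest: subsetD[OF U(2)])
    have rest: "runs (Sub 16 9 12 ;; com.If 16 (Const 17 0) (Add 0 10 11 ;; Add 9 12 11) ;;
        Add 8 8 3 ;; Sub 7 7 6) s 14 (I (Suc i))"
      if s: "case s of (r', \<mu>') \<Rightarrow> \<mu>' = \<mu> \<and>
        (\<forall>a<12. r' a = r2 a) \<and> r' 12 = card {i' \<in> U. g i' = r2 10}" for s
    proof -
      obtain r3 where r3: "s = (r3, \<mu>)" "\<forall>a<12. r3 a = r2 a" "r3 12 = support g U i"
        using s by (cases s) (auto simp: r2_def support_def)
      have **: "r3 a = r1 a" if "a < 10" for a using r3 that by (auto simp: r2_def)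
      have ***: "r3 10 = g i" "r3 11 = 0" using r3 * by (auto simp: r2_def)
      show ?thesis unfolding r3(1)
        using i I *** by (cases "i = 0"; intro runs_intros) (auto simp: I_def * ** r3(3))
    qed
    have "runs (count_loop ;; Sub 16 9 12 ;; com.If 16 (Const 17 0) (Add 0 10 11 ;; Add 9 12 11) ;;
        Add 8 8 3 ;; Sub 7 7 6) (r2, \<mu>) (15 + n * 13) (I (Suc i))"
      by (rule runs_Seq[OF count]) (simp_all add: rest)
    then show "r1 7 \<noteq> 0 \<and> runs (
        Load 10 8 ;; Const 12 0 ;; Add 13 4 11 ;; Add 14 5 11 ;; Add 15 2 11 ;;
        count_loop ;;
        Sub 16 9 12 ;; com.If 16 (Const 17 0) (Add 0 10 11 ;; Add 9 12 11) ;;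
        Add 8 8 3 ;; Sub 7 7 6) (r1, \<mu>1) (n * 13 + 20) (I (Suc i))"
      using i by (intro conjI runs_intros) (simp_all add: * g r2_def)
  qed
  then show ?thesis
    by (rule runs_mono) (use n in \<open>auto simp: I_def plurality_def\<close>)
qed

text \<open>Only 1 is ever written, so the flags of voters served earlier stay 1.\<close>

definition mark_loop :: com where
  "mark_loop = While 15 (
     Load 16 13 ;; Sub 17 16 0 ;; Sub 16 0 16 ;; Add 17 17 16 ;;
     com.If 17 (Const 17 0) (Store 14 6) ;;
     Add 13 13 3 ;; Add 14 14 6 ;; Sub 15 15 6)"

text \<open>Rankings lie below \<open>b\<close> and flags from \<open>b\<close> on, so setting flags
  never destroys votes still to be read.\<close>

lemma runs_mark_loop:
  assumes r: "r 3 = m" "r 6 = 1" "r 13 = p" "r 14 = b" "r 15 = n"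
    and g: "\<And>i. i < n \<Longrightarrow> \<mu> (p + i * m) = g i"
    and b: "\<And>i. i < n \<Longrightarrow> p + i * m < b"
  shows "runs mark_loop (r, \<mu>) (n * 12 + 1) (\<lambda>(r', \<mu>').
    (\<forall>a<12. r' a = r a) \<and> r' 13 = p + n * m \<and> (\<forall>a<b. \<mu>' a = \<mu> a) \<and>
    (\<forall>i<n. \<mu>' (b + i) = (if g i = r 0 then 1 else \<mu> (b + i))))"
proof -
  define I where "I i s = (case s of (r', \<mu>') \<Rightarrow> (\<forall>a<12. r' a = r a) \<and> (\<forall>a<b. \<mu>' a = \<mu> a) \<and>
    (\<forall>i'. \<mu>' (b + i') = (if i' < i \<and> g i' = r 0 then 1 else \<mu> (b + i'))) \<and>
    r' 13 = p + i * m \<and> r' 14 = b + i \<and> r' 15 = n - i)" for i s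
  have "runs mark_loop (r, \<mu>) (n * (11 + 1) + 1) (I n)"
    unfolding mark_loop_def
  proof (rule runs_While)
    show "I 0 (r, \<mu>)" using r by (simp add: I_def)
    show "r' 15 = 0" if "I n (r', \<mu>')" for r' \<mu>' using that by (simp add: I_def)
    fix i r1 \<mu>1 assume i: "i < n" and I: "I i (r1, \<mu>1)"
    have *: "r1 3 = m" "r1 6 = 1" "r1 0 = r 0" "r1 13 = p + i * m" "r1 14 = b + i"
      "r1 15 = n - i" "\<mu>1 (p + i * m) = g i"
      using I r g[OF i] b[OF i] by (auto simp: I_def)
    show "r1 15 \<noteq> 0 \<and> runs (
        Load 16 13 ;; Sub 17 16 0 ;; Sub 16 0 16 ;; Add 17 17 16 ;;
        com.If 17 (Const 17 0) (Store 14 6) ;;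
        Add 13 13 3 ;; Add 14 14 6 ;; Sub 15 15 6) (r1, \<mu>1) 11 (I (Suc i))"
      using i I by (intro conjI runs_intros) (auto simp: I_def * less_Suc_eq)
  qed
  then show ?thesis by (rule runs_mono) (auto simp: I_def)
qed

text \<open>\<open>mark_loop\<close> leaves in register 13 the address behind the last ranking of
  the round, which is where the next round starts.\<close>

definition round_body :: com where
  "round_body =
     Const 9 0 ;; Add 8 4 11 ;; Add 7 2 11 ;; pick_loop ;;
     Add 13 4 11 ;; Add 14 5 11 ;; Add 15 2 11 ;; mark_loop ;;
     Add 4 13 11 ;; Sub 1 1 6"

text \<open>The final flags follow the recursion of \<open>unserved\<close>, so consecutive rounds
  chain.\<close>

lemma runs_round_body:
  assumes r: "r 2 = n" "r 3 = m" "r 4 = p" "r 5 = b" "r 6 = 1" "r 11 = 0"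
    and g: "\<And>i. i < n \<Longrightarrow> \<mu> (p + i * m) = g i"
    and b: "\<And>i. i < n \<Longrightarrow> p + i * m < b"
    and U: "\<And>i. i < n \<Longrightarrow> \<mu> (b + i) = (if i \<in> U then 0 else 1)" "U \<subseteq> {..<n}"
    and n: "n > 0"
  shows "runs round_body (r, \<mu>) (n * (n * 13 + 33) + 10) (\<lambda>(r', \<mu>').
    (\<forall>a\<in>{2, 3, 5, 6, 11}. r' a = r a) \<and> r' 1 = r 1 - 1 \<and> r' 4 = p + n * m \<and>
    r' 0 = plurality n g U \<and> (\<forall>a<b. \<mu>' a = \<mu> a) \<and>
    (\<forall>i<n. \<mu>' (b + i) = (if i \<in> U \<and> g i \<noteq> plurality n g U then 0 else 1)))"
    (is "runs _ _ _ ?Q")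
proof -
  define r1 where "r1 = r(9 := 0, 8 := p, 7 := n)"
  have pick: "runs pick_loop (r1, \<mu>) (n * (n * 13 + 21) + 1)
    (\<lambda>(r', \<mu>'). \<mu>' = \<mu> \<and> (\<forall>a\<in>{1..6} \<union> {11}. r' a = r1 a) \<and> r' 0 = plurality n g U)"
    by (rule runs_pick_loop) (use r g U n in \<open>auto simp: r1_def\<close>)
  have rest: "runs (Add 13 4 11 ;; Add 14 5 11 ;; Add 15 2 11 ;; mark_loop ;;
      Add 4 13 11 ;; Sub 1 1 6) s (n * 12 + 6) ?Q"
    if s: "case s of (r', \<mu>') \<Rightarrow> \<mu>' = \<mu> \<and> (\<forall>a\<in>{1..6} \<union> {11}. r' a = r1 a) \<and>
      r' 0 = plurality n g U" for s
  proof -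
    obtain r2 where r2: "s = (r2, \<mu>)" "\<forall>a\<in>{1..6} \<union> {11}. r2 a = r1 a" "r2 0 = plurality n g U"
      using s by (cases s) auto
    have *: "r2 (Suc 0) = r (Suc 0)" "r2 2 = n" "r2 3 = m" "r2 4 = p" "r2 5 = b" "r2 6 = 1" "r2 11 = 0"
      using r2(2) r by (auto simp: r1_def)
    define r3 where "r3 = r2(13 := p, 14 := b, 15 := n)"
    have mark: "runs mark_loop (r3, \<mu>) (n * 12 + 1) (\<lambda>(r', \<mu>').
      (\<forall>a<12. r' a = r3 a) \<and> r' 13 = p + n * m \<and> (\<forall>a<b. \<mu>' a = \<mu> a) \<and>
      (\<forall>i<n. \<mu>' (b + i) = (if g i = r3 0 then 1 else \<mu> (b + i))))"
      by (rule runs_mark_loop) (use * g b in \<open>auto simp: r3_def\<close>)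
    have "runs (mark_loop ;; Add 4 13 11 ;; Sub 1 1 6) (r3, \<mu>) (3 + n * 12) ?Q"
    proof (rule runs_Seq[OF mark])
      fix s' assume s': "case s' of (r', \<mu>') \<Rightarrow>
        (\<forall>a<12. r' a = r3 a) \<and> r' 13 = p + n * m \<and> (\<forall>a<b. \<mu>' a = \<mu> a) \<and>
        (\<forall>i<n. \<mu>' (b + i) = (if g i = r3 0 then 1 else \<mu> (b + i)))"
      obtain r4 \<mu>4 where r4: "s' = (r4, \<mu>4)" by fastforce
      show "runs (Add 4 13 11 ;; Sub 1 1 6) s' (3 + n * 12 - (n * 12 + 1)) ?Q"
        unfolding r4
        by (intro runs_intros) (use s' r4 r U(1) in \<open>auto simp: r3_def * r2(3)\<close>)
    qed simp
    then show ?thesis unfolding r2(1)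
      by (intro runs_intros) (simp_all add: * r3_def split del: if_split)
  qed
  have "runs (pick_loop ;; Add 13 4 11 ;; Add 14 5 11 ;; Add 15 2 11 ;; mark_loop ;;
      Add 4 13 11 ;; Sub 1 1 6) (r1, \<mu>) (7 + n * (n * 13 + 33)) ?Q"
    by (rule runs_Seq[OF pick], rule runs_mono, erule rest) (auto simp: algebra_simps)
  then show ?thesis unfolding round_body_def
    by (intro runs_intros) (simp_all add: r r1_def split del: if_split)
qed

text \<open>Register 7 initially holds 0, so the loads read cells 0, 1 and 2; registers 4 and 5
  start at 3, the first cell behind this header. The flags start at 0 because memory beyond the
  input is 0.\<close>

definition greedy_program :: com where
  "greedy_program =
     Const 6 1 ;; Load 1 7 ;; Load 2 6 ;; Add 7 6 6 ;; Load 3 7 ;; Add 5 6 7 ;; Add 4 6 7 ;;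
     Add 8 1 11 ;; size_loop ;; While 1 round_body"

text \<open>The pair \<open>(j, i)\<close> is read as the mixed-radix number
  \<open>j * n + i\<close>; the bound keeps first choices inside the input and off the
  flags.\<close>

lemma address_less:
  fixes i j m n T :: nat
  assumes "j < T" "i < n" "m > 0"
  shows "(j * n + i) * m < T * n * m"
proof -
  have "j * n + i < Suc j * n" using assms by simp
  also have "\<dots> \<le> T * n" using assms by (intro mult_right_mono) auto
  finally show ?thesis using assms by simp
qed

lemma runs_greedy_program:
  assumes size: "\<mu> 0 = T" "\<mu> 1 = n" "\<mu> 2 = m" and pos: "T > 0" "n > 0" "m > 0"
    and h: "\<And>i j. j < T \<Longrightarrow> i < n \<Longrightarrow> \<mu> (3 + (j * n + i) * m) = h j i"
    and free: "\<And>i. i < n \<Longrightarrow> \<mu> (3 + T * n * m + i) = 0"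
  shows "runs greedy_program (\<lambda>_. 0, \<mu>) (T * (n * 3 + 4) + T * (n * (n * 13 + 33) + 11) + 10)
    (\<lambda>(r', \<mu>'). r' 0 = winner n h (T - 1))"
proof -
  let ?b = "3 + T * n * m"
  \<comment> \<open>The guard \<open>j > 0\<close> is there because no winner exists before round 0
    has been processed.\<close>
  define I where "I j s = (case s of (r', \<mu>') \<Rightarrow>
    r' 2 = n \<and> r' 3 = m \<and> r' 5 = ?b \<and> r' 6 = 1 \<and> r' 11 = 0 \<and> r' 1 = T - j \<and>
    r' 4 = 3 + j * n * m \<and> (\<forall>a<?b. \<mu>' a = \<mu> a) \<and>
    (\<forall>i<n. \<mu>' (?b + i) = (if i \<in> unserved n h j then 0 else 1)) \<and>
    (j > 0 \<longrightarrow> r' 0 = winner n h (j - 1)))" for j and s :: state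
  have main: "runs (While 1 round_body) s (T * (n * (n * 13 + 33) + 10 + 1) + 1) (I T)"
    if "I 0 s" for s
  proof (rule runs_While)
    show "I 0 s" by fact
    show "r' 1 = 0" if "I T (r', \<mu>')" for r' \<mu>' using that by (simp add: I_def)
    fix j r1 \<mu>1 assume j: "j < T" and I: "I j (r1, \<mu>1)"
    have addr: "3 + j * n * m + i * m < ?b" if "i < n" for i
      using address_less[OF j that pos(3)] by (simp add: algebra_simps)
    have data: "\<mu>1 (3 + j * n * m + i * m) = h j i" if "i < n" for i
      using I addr[OF that] h[OF j that] by (simp add: I_def add_mult_distrib add.assoc)
    have "runs round_body (r1, \<mu>1) (n * (n * 13 + 33) + 10) (\<lambda>(r', \<mu>').
      (\<forall>a\<in>{2, 3, 5, 6, 11}. r' a = r1 a) \<and> r' 1 = r1 1 - 1 \<and>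
      r' 4 = 3 + j * n * m + n * m \<and> r' 0 = plurality n (h j) (unserved n h j) \<and>
      (\<forall>a<?b. \<mu>' a = \<mu>1 a) \<and>
      (\<forall>i<n. \<mu>' (?b + i) = (if i \<in> unserved n h j \<and>
        h j i \<noteq> plurality n (h j) (unserved n h j) then 0 else 1)))"
      by (rule runs_round_body) (use I addr data unserved_subset pos in \<open>auto simp: I_def\<close>)
    then have "runs round_body (r1, \<mu>1) (n * (n * 13 + 33) + 10) (I (Suc j))"
      by (rule runs_mono) (use I in \<open>auto simp: I_def winner_def algebra_simps\<close>)
    then show "r1 1 \<noteq> 0 \<and> runs round_body (r1, \<mu>1) (n * (n * 13 + 33) + 10) (I (Suc j))"
      using j I by (simp add: I_def)
  qed
  \<comment> \<open>The register contents after the eight instructions that precede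
    \<open>size_loop\<close>.\<close>
  define r0 :: "nat \<Rightarrow> nat"
    where "r0 = (\<lambda>_. 0)(6 := 1, 1 := T, 2 := n, 7 := 1 + 1, 3 := m,
      5 := 1 + (1 + 1), 4 := 1 + (1 + 1), 8 := T)"
  have sizes: "\<mu> (Suc 0) = n" "\<mu> (Suc (Suc 0)) = m" using size by (simp_all add: numeral_2_eq_2)
  have init: "runs size_loop (r0, \<mu>) (T * (n * 3 + 4) + 1)
    (\<lambda>(r', \<mu>'). \<mu>' = \<mu> \<and> (\<forall>a. a \<notin> {5, 8, 9} \<longrightarrow> r' a = r0 a) \<and> r' 5 = 3 + T * n * m)"
    by (rule runs_size_loop) (simp_all add: r0_def)
  have "runs (size_loop ;; While 1 round_body) (r0, \<mu>)
      (T * (n * 3 + 4) + T * (n * (n * 13 + 33) + 11) + 2) (I T)"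
  proof (rule runs_Seq[OF init])
    fix s assume s: "case s of (r', \<mu>') \<Rightarrow> \<mu>' = \<mu> \<and>
      (\<forall>a. a \<notin> {5, 8, 9} \<longrightarrow> r' a = r0 a) \<and> r' 5 = 3 + T * n * m"
    then have "I 0 s" using free by (cases s) (simp add: I_def r0_def)
    then show "runs (While 1 round_body) s (T * (n * 3 + 4) + T * (n * (n * 13 + 33) + 11) + 2 -
        (T * (n * 3 + 4) + 1)) (I T)"
      by (rule runs_mono[OF main]) auto
  qed simp
  then have "runs greedy_program (\<lambda>_. 0, \<mu>)
      (T * (n * 3 + 4) + T * (n * (n * 13 + 33) + 11) + 10) (I T)"
    unfolding greedy_program_def
    by (intro runs_intros) (simp_all add: size(1) sizes r0_def)
  then show ?thesis by (rule runs_mono) (use pos in \<open>auto simp: I_def\<close>)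
qed

section \<open>Memory layout of the encoded input and the polynomial time bound\<close>

lemma length_concat_uniform:
  "(\<And>xs. xs \<in> set xss \<Longrightarrow> length xs = m) \<Longrightarrow> length (concat xss) = length xss * m"
  by (induction xss) auto

lemma concat_uniform_nth:
  assumes "\<And>xs. xs \<in> set xss \<Longrightarrow> length xs = m" "i < length xss" "k < m"
  shows "concat xss ! (i * m + k) = xss ! i ! k"
  using assms
proof (induction xss arbitrary: i)
  case (Cons xs xss)
  then show ?case by (cases i) (auto simp: nth_append)
qed simp

lemma encode_layout:
  assumes P: "is_profile n C T P"
  defines "m \<equiv> card C"
  shows "m > 0" "encode P = [T, n, m] @ concat (map concat P)"
    "length (encode P) = 3 + T * n * m"
    "j < T \<Longrightarrow> i < n \<Longrightarrow> encode P ! (3 + (j * n + i) * m) = first_choice P j i"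
proof -
  have len: "length P = T" "T \<ge> 1" "n \<ge> 1" "length (P ! j) = n"
    "length (P ! j ! i) = m" if "j < T" "i < n" for i j
    using P that distinct_card[of "P ! j ! i"] by (auto simp: is_profile_def m_def)
  have T: "length P = T" "T \<ge> 1" "n \<ge> 1" using P by (auto simp: is_profile_def)
  show m: "m > 0" using P by (auto simp: is_profile_def m_def card_gt_0_iff)
  show enc: "encode P = [T, n, m] @ concat (map concat P)"
    using len[of 0 0] T by (simp add: encode_def)
  have votes: "length (concat R) = n * m" if "R \<in> set P" for R
    using that len T by (subst length_concat_uniform[of _ m]) (auto simp: in_set_conv_nth)
  have "length (concat (map concat P)) = T * (n * m)"
    by (subst length_concat_uniform[of _ "n * m"]) (use votes T in auto)
  then show "length (encode P) = 3 + T * n * m" by (simp add: enc)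
  show "encode P ! (3 + (j * n + i) * m) = first_choice P j i" if j: "j < T" and i: "i < n"
  proof -
    have "encode P ! (3 + (j * n + i) * m) = concat (map concat P) ! (j * (n * m) + i * m)"
      by (simp add: enc numeral_3_eq_3 algebra_simps)
    \<comment> \<open>The block formula is applied twice: rounds are blocks of \<open>n * m\<close>
      cells, rankings blocks of \<open>m\<close> cells, and a first choice has offset 0 in its
      block.\<close>
    also have "\<dots> = concat (P ! j) ! (i * m + 0)"
      using address_less[of 0 1 i n m] i j m votes T
      by (subst concat_uniform_nth) auto
    also have "\<dots> = P ! j ! i ! 0"
      using len[OF j] i m j by (intro concat_uniform_nth) (auto simp: in_set_conv_nth)
    also have "\<dots> = first_choice P j i"
      using len(5)[OF j i] m by (auto simp: first_choice_def hd_conv_nth)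
    finally show ?thesis .
  qed
qed

text \<open>As \<open>T\<close>, \<open>n\<close> and \<open>m\<close> are positive, the input
  length \<open>3 + T * n * m\<close> bounds both \<open>T\<close> and \<open>n\<close>;
  substituting it for both in the running time gives the polynomial.\<close>

lemma poly_time_greedy: "poly_time greedy_rule"
proof -
  let ?X = "[:0, 1:] :: nat poly"
  let ?p = "?X * (?X * 3 + 4) + ?X * (?X * (?X * 13 + 33) + 11) + 10"
  have "\<exists>t r m. exec greedy_program (initial_state (encode P)) t (r, m) \<and>
      t \<le> poly ?p (length (encode P)) \<and> r 0 = greedy_rule P" if P: "is_profile n C T P" for n C T P
  proof -
    note enc = encode_layout[OF P]
    let ?m = "card C" and ?L = "length (encode P)"
    have T: "T > 0" "n > 0" "length P = T" "length (P ! 0) = n"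
      using P by (auto simp: is_profile_def)
    let ?\<mu> = "\<lambda>a. if a < ?L then encode P ! a else 0"
    have "runs greedy_program (\<lambda>_. 0, ?\<mu>) (T * (n * 3 + 4) + T * (n * (n * 13 + 33) + 11) + 10)
      (\<lambda>(r', \<mu>'). r' 0 = winner n (first_choice P) (T - 1))"
    proof (rule runs_greedy_program)
      show "?\<mu> 0 = T" "?\<mu> 1 = n" "?\<mu> 2 = ?m" by (simp_all add: enc(2))
      show "?\<mu> (3 + (j * n + i) * ?m) = first_choice P j i" if "j < T" "i < n" for i j
        using address_less[OF that enc(1)] enc(3) enc(4)[OF that] by simp
    qed (use T enc in auto)
    then obtain t r \<mu>' where run: "exec greedy_program (\<lambda>_. 0, ?\<mu>) t (r, \<mu>')"
        "t \<le> T * (n * 3 + 4) + T * (n * (n * 13 + 33) + 11) + 10"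
        "r 0 = winner n (first_choice P) (T - 1)"
      by (auto simp: runs_def)
    have "T * 1 * 1 \<le> T * n * ?m" "1 * n * 1 \<le> T * n * ?m"
      using T enc(1) by (intro mult_mono; simp)+
    then have L: "T \<le> ?L" "n \<le> ?L" unfolding enc(3) by linarith+
    note run(2)
    also have "T * (n * 3 + 4) + T * (n * (n * 13 + 33) + 11) + 10
        \<le> ?L * (?L * 3 + 4) + ?L * (?L * (?L * 13 + 33) + 11) + 10"
      using L by (intro add_mono mult_mono) auto
    also have "\<dots> = poly ?p ?L" by (simp add: algebra_simps)
    finally have "t \<le> poly ?p ?L" .
    moreover have "r 0 = greedy_rule P" using run(3) T by (simp add: greedy_rule_def)
    ultimately show ?thesis
      using run(1) unfolding initial_state_def by (intro exI conjI)
  qed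
  then show ?thesis unfolding poly_time_def by blast
qed


theorem theorem5p3:
  "(\<forall>d T :: nat. d \<ge> 1 \<longrightarrow> T \<ge> 1 \<longrightarrow>
      ((\<forall>n C P. is_profile n C T P \<and> at_most_first_choices d n P \<longrightarrow>
          (\<exists>W. is_outcome C T W \<and> all_rank_JR n C T P W))
        \<longleftrightarrow> real T * (1 - 1 / real d) ^ T < 1) \<and>
      ((\<forall>n C P. is_profile n C T P \<and> at_most_first_choices d n P \<longrightarrow>
          (\<exists>W. is_outcome C T W \<and> all_rank_wJR n C T P W))
        \<longleftrightarrow> real T * (1 - 1 / real d) ^ T < 1)) \<and>
   (\<exists>f. online_rule f \<and> poly_time f \<and>
      (\<forall>d T :: nat. d \<ge> 1 \<longrightarrow> T \<ge> 1 \<longrightarrow> real T * (1 - 1 / real d) ^ T < 1 \<longrightarrow>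
        (\<forall>n C P. is_profile n C T P \<and> at_most_first_choices d n P \<longrightarrow>
          all_rank_JR n C T P (online_outcome f P))))"
proof (intro conjI allI impI)
  fix d T :: nat
  assume d: "d \<ge> 1" and T: "T \<ge> 1"
  let ?small = "real T * (1 - 1 / real d) ^ T < 1"
  let ?JR = "\<forall>n C P. is_profile n C T P \<and> at_most_first_choices d n P \<longrightarrow>
    (\<exists>W. is_outcome C T W \<and> all_rank_JR n C T P W)"
  let ?wJR = "\<forall>n C P. is_profile n C T P \<and> at_most_first_choices d n P \<longrightarrow>
    (\<exists>W. is_outcome C T W \<and> all_rank_wJR n C T P W)"
  \<comment> \<open>The implications form a cycle, which yields both equivalences at once.\<close>
  have 1: "?small \<Longrightarrow> ?JR"
    using greedy_all_rank_JR[OF _ _ d] online_rule_greedy unfolding online_rule_def by meson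
  have 2: "?JR \<Longrightarrow> ?wJR" using all_rank_JR_imp_wJR[OF T] by meson
  have 3: "?wJR \<Longrightarrow> ?small" using ex_profile_no_wJR[OF d T] by (meson not_le)
  show "?JR \<longleftrightarrow> ?small" using 1 2 3 by argo
  show "?wJR \<longleftrightarrow> ?small" using 1 2 3 by argo
next
  show "\<exists>f. online_rule f \<and> poly_time f \<and>
      (\<forall>d T :: nat. d \<ge> 1 \<longrightarrow> T \<ge> 1 \<longrightarrow> real T * (1 - 1 / real d) ^ T < 1 \<longrightarrow>
        (\<forall>n C P. is_profile n C T P \<and> at_most_first_choices d n P \<longrightarrow>
          all_rank_JR n C T P (online_outcome f P)))"
    using online_rule_greedy poly_time_greedy greedy_all_rank_JR by blast
qed

end
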